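(* Let $\mathbb{F}$ be a field, let $G(\lambda)\in\mathbb{F}(\lambda)^{p\times m}$, and let $$\mathcal{L}(\lambda)=\begin{bmatrix} A_1\lambda+A_0 & B_1\lambda+B_0\\ -(C_1\lambda+C_0) & D_1\lambda+D_0\end{bmatrix}\in\mathbb{F}[\lambda]^{(n+p)\times(n+m)}$$ be a linear polynomial system matrix of $G(\lambda)$ with state matrix $A(\lambda):=A_1\lambda+A_0\in\mathbb{F}[\lambda]^{n\times n}$. If $A(\lambda)$ is unimodular, then $G(\lambda)$ is a matrix polynomial and $\mathcal{L}(\lambda)$ is a linearization of $G(\lambda)$.
   Context: $\mathbb{F}$ is an arbitrary field; $\mathbb{F}[\lambda]^{p\times m}$ and $\mathbb{F}(\lambda)^{p\times m}$ denote the $p\times m$ matrices with polynomial, respectively rational, entries. Elements of $\mathbb{F}[\lambda]^{p\times m}$ are called matrix polynomials or polynomial matrices; a pencil is a matrix polynomial of degree at most $1$. A square polynomial matrix is regular if its determinant is not identically zero, and unimodular if its determinant is a nonzero constant. A polynomial system matrix of a rational matrix $G(\lambda)\in\mathbb{F}(\lambda)^{p\times m}$ is a polynomial matrix $S(\lambda)=\begin{bmatrix}A(\lambda)&B(\lambda)\\-C(\lambda)&D(\lambda)\end{bmatrix}\in\mathbb{F}[\lambda]^{(n+p)\times(n+m)}$ with $A(\lambda)\in\mathbb{F}[\lambda]^{n\times n}$ regular, such that $G(\lambda)=D(\lambda)+C(\lambda)A(\lambda)^{-1}B(\lambda)$. Then $A(\lambda)$ is called the state matrix and $G(\lambda)$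 the transfer function matrix of $S(\lambda)$. It is called linear if $S(\lambda)$ is a pencil. A linearization of a matrix polynomial $P(\lambda)\in\mathbb{F}[\lambda]^{p\times m}$ is a pencil $L(\lambda)$ for which there exist unimodular matrices $U_1(\lambda),V_1(\lambda)$ and an integer $s\ge 0$ with $U_1(\lambda)L(\lambda)V_1(\lambda)=\begin{bmatrix}P(\lambda)&0\\0&I_s\end{bmatrix}$. *)

theory Defs
  imports
    "Jordan_Normal_Form.Determinant"
    "Jordan_Normal_Form.Gauss_Jordan_Elimination"
begin

text \<open>
  Polynomial matrices over a field \<open>'a\<close> have type \<open>'a poly mat\<close>, rational matrices have type
  \<open>'a poly fract mat\<close>, where \<open>'a poly fract\<close> is the field of fractions of \<open>'a poly\<close>.
\<close>

abbreviation to_rat_mat :: "'a :: field poly mat \<Rightarrow> 'a poly fract mat" where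
  "to_rat_mat \<equiv> map_mat to_fract"

definition pencil :: "'a :: field poly mat \<Rightarrow> bool" where
  "pencil L \<longleftrightarrow> (\<forall>i < dim_row L. \<forall>j < dim_col L. degree (L $$ (i, j)) \<le> 1)"

definition linear_mat :: "'a :: field mat \<Rightarrow> 'a mat \<Rightarrow> 'a poly mat" where
  "linear_mat M1 M0 = [:0, 1:] \<cdot>\<^sub>m map_mat (\<lambda>a. [:a:]) M1 + map_mat (\<lambda>a. [:a:]) M0"

definition regular_mat :: "'a :: field poly mat \<Rightarrow> bool" where
  "regular_mat A \<longleftrightarrow> square_mat A \<and> det A \<noteq> 0"

definition unimodular_mat :: "'a :: field poly mat \<Rightarrow> bool" where
  "unimodular_mat U \<longleftrightarrow> square_mat U \<and> (\<exists>c. c \<noteq> 0 \<and> det U = [:c:])"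

text \<open>
  \<open>system_matrix_of S A G\<close>: \<open>S\<close> is a polynomial system matrix of \<open>G\<close> with state matrix \<open>A\<close>.
  The size of \<open>A\<close> fixes the partition of \<open>S\<close>, so \<open>B\<close>, \<open>C\<close>, \<open>D\<close> are determined by \<open>S\<close> and \<open>A\<close>.
  The function \<open>mat_inverse\<close> returns an option; the value is \<open>Some\<close> here because \<open>A\<close> is regular.
\<close>

definition system_matrix_of ::
    "'a :: field poly mat \<Rightarrow> 'a poly mat \<Rightarrow> 'a poly fract mat \<Rightarrow> bool" where
  "system_matrix_of S A G \<longleftrightarrow> (\<exists>n p m B C D.
     A \<in> carrier_mat n n \<and> B \<in> carrier_mat n m \<and> C \<in> carrier_mat p n \<and> D \<in> carrier_mat p m \<and>
     S = four_block_mat A B (- C) D \<and>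
     regular_mat A \<and>
     G = to_rat_mat D + to_rat_mat C * the (mat_inverse (to_rat_mat A)) * to_rat_mat B)"

definition linear_system_matrix_of ::
    "'a :: field poly mat \<Rightarrow> 'a poly mat \<Rightarrow> 'a poly fract mat \<Rightarrow> bool" where
  "linear_system_matrix_of S A G \<longleftrightarrow> system_matrix_of S A G \<and> pencil S"

text \<open>
  The product of matrices is total, so the sizes of \<open>U\<close> and \<open>V\<close> have to be prescribed.
\<close>

definition linearization_of :: "'a :: field poly mat \<Rightarrow> 'a poly mat \<Rightarrow> bool" where
  "linearization_of L P \<longleftrightarrow> pencil L \<and>
     (\<exists>U V s. U \<in> carrier_mat (dim_row L) (dim_row L) \<and> unimodular_mat U \<and>
        V \<in> carrier_mat (dim_col L) (dim_col L) \<and> unimodular_mat V \<and>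
        U * L * V = four_block_mat P (0\<^sub>m (dim_row P) s) (0\<^sub>m s (dim_col P)) (1\<^sub>m s))"

end

theory Submission
  imports Defs
begin

text \<open>
  Write \<open>A\<close>, \<open>B\<close>, \<open>C\<close>, \<open>D\<close> for the blocks of the system matrix \<open>L\<close> (with lower left block
  \<open>- C\<close>). Since \<open>det A\<close> is a nonzero constant, Cramer's rule gives a polynomial inverse \<open>X\<close> of \<open>A\<close>.
  Hence the transfer function is the image of the polynomial matrix \<open>P = D + C X B\<close>: embedding
  \<open>X\<close> into the rational matrices yields the rational inverse of \<open>A\<close>, by uniqueness of inverses
  (\<open>mat_inverse_to_rat_mat\<close>).

  Block elimination with pivot \<open>A\<close> needs no inverse other than \<open>X\<close>, so it can be done over the
  polynomials. It brings \<open>L\<close> to the form \<open>diag(A, P)\<close>; scaling the first block row by \<open>X\<close> and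
  exchanging the two blocks then gives \<open>diag(P, I)\<close>. The accumulated row and column operations are
  two explicit block matrices (\<open>block_elimination\<close>). They are unimodular
  because each has a polynomial right inverse (\<open>unimodular_mat_if_right_inverse\<close>), which avoids
  evaluating the sign that the block exchange contributes to their determinants.
\<close>

section \<open>Unimodular matrices and polynomial inverses\<close>

text \<open>
  Determinants multiply, so a right inverse makes the determinant a unit, and the units among the
  polynomials over a field are the nonzero constants.
\<close>

lemma unimodular_mat_if_right_inverse:
  assumes U: "U \<in> carrier_mat n n" and W: "W \<in> carrier_mat n n" and UW: "U * W = 1\<^sub>m n"
  shows "unimodular_mat U"
proof -
  have "det U * det W = 1"
    using det_mult[OF U W] UW by simp
  then have "det U dvd 1"
    by (metis dvd_triv_left)
  then obtain c where c: "det U = [:c:]" "c dvd 1"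
    by (rule is_unit_polyE)
  then have "c \<noteq> 0"
    by auto
  then show ?thesis
    using U c(1) unfolding unimodular_mat_def by auto
qed

text \<open>
  Dividing the adjugate by the determinant does not leave the polynomials, since the determinant is
  constant.
\<close>

lemma unimodular_mat_obtain_inverse:
  assumes A: "A \<in> carrier_mat n n" and uni: "unimodular_mat A"
  obtains X where "X \<in> carrier_mat n n" "A * X = 1\<^sub>m n" "X * A = 1\<^sub>m n"
proof -
  from uni obtain c where c: "c \<noteq> 0" "det A = [:c:]"
    unfolding unimodular_mat_def by auto
  let ?X = "[:inverse c:] \<cdot>\<^sub>m adj_mat A"
  have scaled: "[:inverse c:] \<cdot>\<^sub>m ([:c:] \<cdot>\<^sub>m 1\<^sub>m n) = 1\<^sub>m n"
    using c by (intro eq_matI) (auto simp: one_pCons)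
  note adj = adj_mat[OF A]
  show thesis
  proof
    show "?X \<in> carrier_mat n n"
      using adj(1) by simp
    show "A * ?X = 1\<^sub>m n"
      using mult_smult_distrib[OF A adj(1)] adj(2) c(2) scaled by simp
    show "?X * A = 1\<^sub>m n"
      using mult_smult_assoc_mat[OF adj(1) A] adj(3) c(2) scaled by simp
  qed
qed

text \<open>
  Inverses over the field of fractions are unique, and the embedding preserves products. This is what
  allows a polynomial inverse to replace the rational inverse in the transfer function.
\<close>

lemma mat_inverse_to_rat_mat:
  fixes A X :: "'a :: field poly mat"
  assumes A: "A \<in> carrier_mat n n" and X: "X \<in> carrier_mat n n"
    and AX: "A * X = 1\<^sub>m n" and XA: "X * A = 1\<^sub>m n"
  shows "mat_inverse (to_rat_mat A) = Some (to_rat_mat X)"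
proof -
  interpret semiring_hom "to_fract :: 'a poly \<Rightarrow> 'a poly fract"
    by unfold_locales auto
  let ?A = "to_rat_mat A" and ?X = "to_rat_mat X"
  have A': "?A \<in> carrier_mat n n" and X': "?X \<in> carrier_mat n n"
    using A X by auto
  have AX': "?A * ?X = 1\<^sub>m n" and XA': "?X * ?A = 1\<^sub>m n"
    using mat_hom_mult[OF A X] mat_hom_mult[OF X A] AX XA by (simp_all add: mat_hom_one)
  show ?thesis
  proof (cases "mat_inverse ?A")
    case None
    have "?A \<in> Units (ring_mat TYPE('a poly fract) n ())"
      using A' X' AX' XA' unfolding Units_def ring_mat_def by auto
    then show ?thesis
      using mat_inverse(1)[OF A' None, of "()"] by simp
  next
    case (Some Y)
    then have Y: "?A * Y = 1\<^sub>m n" "Y \<in> carrier_mat n n"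
      using mat_inverse(2)[OF A'] by blast+
    have "Y = (?X * ?A) * Y"
      using Y(2) XA' by simp
    also have "\<dots> = ?X * (?A * Y)"
      using assoc_mult_mat[OF X' A' Y(2)] .
    also have "\<dots> = ?X"
      using Y(1) X' by simp
    finally show ?thesis
      using Some by simp
  qed
qed

section \<open>Block elimination\<close>

text \<open>
  For the first factor, scaling the first block row by \<open>X\<close> turns the pivot \<open>A\<close> into the identity;
  adding \<open>C\<close> times the result to the second block row clears \<open>- C\<close>; the exchanged block rows
  account for the position of the blocks of the factor. The second factor clears the remaining
  block \<open>X * B\<close> and exchanges the block columns.
\<close>

lemma block_elimination:
  fixes A B C D X :: "'a :: comm_ring_1 mat"
  assumes A: "A \<in> carrier_mat n n" and B: "B \<in> carrier_mat n m"
    and C: "C \<in> carrier_mat p n" and D: "D \<in> carrier_mat p m"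
    and X: "X \<in> carrier_mat n n" and XA: "X * A = 1\<^sub>m n"
  shows "four_block_mat (C * X) (1\<^sub>m p) X (0\<^sub>m n p) * four_block_mat A B (- C) D
      * four_block_mat (- (X * B)) (1\<^sub>m n) (1\<^sub>m m) (0\<^sub>m m n)
    = four_block_mat (D + C * X * B) (0\<^sub>m p n) (0\<^sub>m n m) (1\<^sub>m n)"
proof -
  have CXA: "C * X * A = C"
    using assoc_mult_mat[OF C X A] XA C by simp
  have XB: "X * B \<in> carrier_mat n m" and CX: "C * X \<in> carrier_mat p n"
    and CXB: "C * X * B \<in> carrier_mat p m"
    using B C X by auto
  have "four_block_mat (C * X) (1\<^sub>m p) X (0\<^sub>m n p) * four_block_mat A B (- C) D
      = four_block_mat (C * X * A + 1\<^sub>m p * - C) (C * X * B + 1\<^sub>m p * D)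
          (X * A + 0\<^sub>m n p * - C) (X * B + 0\<^sub>m n p * D)"
    using A B C D X by (intro mult_four_block_mat) auto
  also have "\<dots> = four_block_mat (0\<^sub>m p n) (D + C * X * B) (1\<^sub>m n) (X * B)"
  proof (rule cong_four_block_mat)
    show "C * X * A + 1\<^sub>m p * - C = 0\<^sub>m p n"
      using CXA C by auto
    show "C * X * B + 1\<^sub>m p * D = D + C * X * B"
      using comm_add_mat[OF D CXB] left_mult_one_mat[OF D] by simp
    show "X * A + 0\<^sub>m n p * - C = 1\<^sub>m n"
      using XA left_mult_zero_mat[of "- C" p n n] C by simp
    show "X * B + 0\<^sub>m n p * D = X * B"
      using XB D by simp
  qed
  finally have rows: "four_block_mat (C * X) (1\<^sub>m p) X (0\<^sub>m n p) * four_block_mat A B (- C) D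
      = four_block_mat (0\<^sub>m p n) (D + C * X * B) (1\<^sub>m n) (X * B)" .
  have "four_block_mat (0\<^sub>m p n) (D + C * X * B) (1\<^sub>m n) (X * B)
        * four_block_mat (- (X * B)) (1\<^sub>m n) (1\<^sub>m m) (0\<^sub>m m n)
      = four_block_mat (0\<^sub>m p n * - (X * B) + (D + C * X * B) * 1\<^sub>m m)
          (0\<^sub>m p n * 1\<^sub>m n + (D + C * X * B) * 0\<^sub>m m n)
          (1\<^sub>m n * - (X * B) + X * B * 1\<^sub>m m) (1\<^sub>m n * 1\<^sub>m n + X * B * 0\<^sub>m m n)"
    using XB D CXB by (intro mult_four_block_mat) auto
  also have "\<dots> = four_block_mat (D + C * X * B) (0\<^sub>m p n) (0\<^sub>m n m) (1\<^sub>m n)"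
  proof (rule cong_four_block_mat)
    show "0\<^sub>m p n * - (X * B) + (D + C * X * B) * 1\<^sub>m m = D + C * X * B"
      using left_mult_zero_mat[of "- (X * B)" n m p] XB
        right_mult_one_mat[OF add_carrier_mat[OF CXB, of D]]
        left_add_zero_mat[OF add_carrier_mat[OF CXB, of D]]
      by simp
    show "0\<^sub>m p n * 1\<^sub>m n + (D + C * X * B) * 0\<^sub>m m n = 0\<^sub>m p n"
      using right_mult_zero_mat[OF add_carrier_mat[OF CXB, of D], of n] by simp
    show "1\<^sub>m n * - (X * B) + X * B * 1\<^sub>m m = 0\<^sub>m n m"
      using uminus_l_inv_mat[OF XB] right_mult_one_mat[OF XB]
        left_mult_one_mat[of "- (X * B)" n m] XB by simp
    show "1\<^sub>m n * 1\<^sub>m n + X * B * 0\<^sub>m m n = 1\<^sub>m n"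
      using right_mult_zero_mat[OF XB, of n] by simp
  qed
  finally show ?thesis
    unfolding rows .
qed

text \<open>
  The inverse undoes the row operations in reverse order: it exchanges the block rows back, subtracts
  \<open>C\<close> times the scaled block row, and scales by \<open>A\<close>.
\<close>

lemma row_factor_right_inverse:
  fixes A C X :: "'a :: comm_ring_1 mat"
  assumes A: "A \<in> carrier_mat n n" and C: "C \<in> carrier_mat p n"
    and X: "X \<in> carrier_mat n n" and XA: "X * A = 1\<^sub>m n"
  shows "four_block_mat (C * X) (1\<^sub>m p) X (0\<^sub>m n p) * four_block_mat (0\<^sub>m n p) A (1\<^sub>m p) (- C)
    = 1\<^sub>m (p + n)"
proof -
  have CXA: "C * X * A = C"
    using assoc_mult_mat[OF C X A] XA C by simp
  have CX: "C * X \<in> carrier_mat p n"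
    using C X by auto
  have "four_block_mat (C * X) (1\<^sub>m p) X (0\<^sub>m n p) * four_block_mat (0\<^sub>m n p) A (1\<^sub>m p) (- C)
      = four_block_mat (C * X * 0\<^sub>m n p + 1\<^sub>m p * 1\<^sub>m p) (C * X * A + 1\<^sub>m p * - C)
          (X * 0\<^sub>m n p + 0\<^sub>m n p * 1\<^sub>m p) (X * A + 0\<^sub>m n p * - C)"
    using A C X by (intro mult_four_block_mat) auto
  also have "\<dots> = four_block_mat (1\<^sub>m p) (0\<^sub>m p n) (0\<^sub>m n p) (1\<^sub>m n)"
  proof (rule cong_four_block_mat)
    show "C * X * 0\<^sub>m n p + 1\<^sub>m p * 1\<^sub>m p = 1\<^sub>m p"
      using right_mult_zero_mat[OF CX, of p] by simp
    show "C * X * A + 1\<^sub>m p * - C = 0\<^sub>m p n"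
      using CXA C by auto
    show "X * 0\<^sub>m n p + 0\<^sub>m n p * 1\<^sub>m p = 0\<^sub>m n p"
      using X by simp
    show "X * A + 0\<^sub>m n p * - C = 1\<^sub>m n"
      using XA left_mult_zero_mat[of "- C" p n n] C by simp
  qed
  finally show ?thesis
    by simp
qed

lemma column_factor_right_inverse:
  fixes Y :: "'a :: comm_ring_1 mat"
  assumes Y: "Y \<in> carrier_mat n m"
  shows "four_block_mat (- Y) (1\<^sub>m n) (1\<^sub>m m) (0\<^sub>m m n) * four_block_mat (0\<^sub>m m n) (1\<^sub>m m) (1\<^sub>m n) Y
    = 1\<^sub>m (n + m)"
proof -
  have "four_block_mat (- Y) (1\<^sub>m n) (1\<^sub>m m) (0\<^sub>m m n) * four_block_mat (0\<^sub>m m n) (1\<^sub>m m) (1\<^sub>m n) Y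
      = four_block_mat (- Y * 0\<^sub>m m n + 1\<^sub>m n * 1\<^sub>m n) (- Y * 1\<^sub>m m + 1\<^sub>m n * Y)
          (1\<^sub>m m * 0\<^sub>m m n + 0\<^sub>m m n * 1\<^sub>m n) (1\<^sub>m m * 1\<^sub>m m + 0\<^sub>m m n * Y)"
    using Y by (intro mult_four_block_mat) auto
  also have "\<dots> = four_block_mat (1\<^sub>m n) (0\<^sub>m n m) (0\<^sub>m m n) (1\<^sub>m m)"
  proof (rule cong_four_block_mat)
    show "- Y * 0\<^sub>m m n + 1\<^sub>m n * 1\<^sub>m n = 1\<^sub>m n"
      using Y by simp
    show "- Y * 1\<^sub>m m + 1\<^sub>m n * Y = 0\<^sub>m n m"
      using Y by auto
    show "1\<^sub>m m * 0\<^sub>m m n + 0\<^sub>m m n * 1\<^sub>m n = 0\<^sub>m m n"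
      by simp
    show "1\<^sub>m m * 1\<^sub>m m + 0\<^sub>m m n * Y = 1\<^sub>m m"
      using Y by simp
  qed
  finally show ?thesis
    by simp
qed

lemma linearization_of_schur_complement:
  fixes A B C D X :: "'a :: field poly mat"
  assumes A: "A \<in> carrier_mat n n" and B: "B \<in> carrier_mat n m"
    and C: "C \<in> carrier_mat p n" and D: "D \<in> carrier_mat p m"
    and X: "X \<in> carrier_mat n n" and XA: "X * A = 1\<^sub>m n"
    and pencil: "pencil (four_block_mat A B (- C) D)"
  shows "linearization_of (four_block_mat A B (- C) D) (D + C * X * B)"
proof -
  let ?U = "four_block_mat (C * X) (1\<^sub>m p) X (0\<^sub>m n p)"
  let ?V = "four_block_mat (- (X * B)) (1\<^sub>m n) (1\<^sub>m m) (0\<^sub>m m n)"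
  let ?L = "four_block_mat A B (- C) D" and ?P = "D + C * X * B"
  have XB: "X * B \<in> carrier_mat n m" and CX: "C * X \<in> carrier_mat p n"
    using X B C by auto
  have U: "?U \<in> carrier_mat (p + n) (p + n)"
    using four_block_carrier_mat[OF CX, of "0\<^sub>m n p" n p] by (simp add: add.commute)
  have V: "?V \<in> carrier_mat (n + m) (n + m)"
    using four_block_carrier_mat[of "- (X * B)" n m "0\<^sub>m m n" m n] XB by (simp add: add.commute)
  have dims: "dim_row ?L = p + n" "dim_col ?L = n + m"
    "dim_row ?P = p" "dim_col ?P = m"
    using A B C D by auto
  have "four_block_mat (0\<^sub>m n p) A (1\<^sub>m p) (- C) \<in> carrier_mat (p + n) (p + n)"
    using four_block_carrier_mat[of "0\<^sub>m n p" n p "- C" p n] C by (simp add: add.commute)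
  then have uniU: "unimodular_mat ?U"
    using unimodular_mat_if_right_inverse[OF U] row_factor_right_inverse[OF A C X XA] by blast
  have "four_block_mat (0\<^sub>m m n) (1\<^sub>m m) (1\<^sub>m n) (X * B) \<in> carrier_mat (n + m) (n + m)"
    using four_block_carrier_mat[of "0\<^sub>m m n" m n "X * B" n m] XB by (simp add: add.commute)
  then have uniV: "unimodular_mat ?V"
    using unimodular_mat_if_right_inverse[OF V] column_factor_right_inverse[OF XB] by blast
  show ?thesis
    unfolding linearization_of_def dims
    using pencil U V uniU uniV block_elimination[OF A B C D X XA] by blast
qed

section \<open>Linear system matrices with unimodular state matrix\<close>

lemma four_block_mat_inject:
  assumes A: "A \<in> carrier_mat n k" and D: "D \<in> carrier_mat p m"
    and B: "B \<in> carrier_mat n m" "B' \<in> carrier_mat n m"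
    and C: "C \<in> carrier_mat p k" "C' \<in> carrier_mat p k"
    and D': "D' \<in> carrier_mat p m"
    and eq: "four_block_mat A B C D = four_block_mat A B' C' D'"
  shows "B = B' \<and> C = C' \<and> D = D'"
proof -
  have entry: "four_block_mat A B C D $$ (i, j) = four_block_mat A B' C' D' $$ (i, j)" for i j
    using eq by simp
  have "B = B'"
  proof (rule eq_matI)
    show "B $$ (i, j) = B' $$ (i, j)" if "i < dim_row B'" "j < dim_col B'" for i j
      using entry[of i "k + j"] that A B D D' by simp
  qed (use B in auto)
  moreover have "C = C'"
  proof (rule eq_matI)
    show "C $$ (i, j) = C' $$ (i, j)" if "i < dim_row C'" "j < dim_col C'" for i j
      using entry[of "n + i" j] that A C D D' by simp
  qed (use C in auto)
  moreover have "D = D'"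
  proof (rule eq_matI)
    show "D $$ (i, j) = D' $$ (i, j)" if "i < dim_row D'" "j < dim_col D'" for i j
      using entry[of "n + i" "k + j"] that A D D' by simp
  qed (use D D' in auto)
  ultimately show ?thesis
    by blast
qed

text \<open>
  Here the state matrix only determines the partition of \<open>S\<close>, so the blocks have to be compared with
  those that witness the system matrix property before the transfer function can be read off.
\<close>

lemma system_matrix_of_four_block_matD:
  assumes A: "A \<in> carrier_mat n n" and B: "B \<in> carrier_mat n m"
    and C: "C \<in> carrier_mat p n" and D: "D \<in> carrier_mat p m"
    and sys: "system_matrix_of (four_block_mat A B (- C) D) A G"
  shows "G = to_rat_mat D
    + to_rat_mat C * the (mat_inverse (to_rat_mat A)) * to_rat_mat B"
proof -
  from sys obtain n' p' m' B' C' D' where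
    carriers: "A \<in> carrier_mat n' n'" "B' \<in> carrier_mat n' m'" "C' \<in> carrier_mat p' n'"
      "D' \<in> carrier_mat p' m'"
    and eq: "four_block_mat A B (- C) D = four_block_mat A B' (- C') D'"
    and G: "G = to_rat_mat D' + to_rat_mat C' * the (mat_inverse (to_rat_mat A)) * to_rat_mat B'"
    unfolding system_matrix_of_def by blast
  have "n' = n"
    using A carriers(1) by auto
  moreover have "p' = p"
    using arg_cong[OF eq, of dim_row] D carriers(4) by simp
  moreover have "m' = m"
    using arg_cong[OF eq, of dim_col] D carriers(4) by simp
  ultimately have B': "B' \<in> carrier_mat n m" and C': "C' \<in> carrier_mat p n"
    and D': "D' \<in> carrier_mat p m"
    using carriers by auto
  have blocks: "B = B' \<and> - C = - C' \<and> D = D'"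
    using four_block_mat_inject[OF A D B B' _ _ D' eq] C C' by simp
  then have "- (- C) = - (- C')"
    by simp
  then have "C = C'"
    by simp
  then show ?thesis
    using G blocks by simp
qed

lemma to_rat_mat_add:
  assumes "M \<in> carrier_mat r c" "N \<in> carrier_mat r c"
  shows "to_rat_mat (M + N) = to_rat_mat M + to_rat_mat N"
  using assms by (intro eq_matI) auto

lemma linear_mat_carrier:
  assumes "M1 \<in> carrier_mat r c" "M0 \<in> carrier_mat r c"
  shows "linear_mat M1 M0 \<in> carrier_mat r c"
  using assms unfolding linear_mat_def by auto

theorem proposition3p1:
  fixes G :: "'a :: field poly fract mat"
    and A1 A0 B1 B0 C1 C0 D1 D0 :: "'a mat"
    and L A :: "'a poly mat"
    and n p m :: nat
  assumes "G \<in> carrier_mat p m"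
    and "A1 \<in> carrier_mat n n" and "A0 \<in> carrier_mat n n"
    and "B1 \<in> carrier_mat n m" and "B0 \<in> carrier_mat n m"
    and "C1 \<in> carrier_mat p n" and "C0 \<in> carrier_mat p n"
    and "D1 \<in> carrier_mat p m" and "D0 \<in> carrier_mat p m"
    and "A = linear_mat A1 A0"
    and "L = four_block_mat A (linear_mat B1 B0) (- linear_mat C1 C0) (linear_mat D1 D0)"
    and "linear_system_matrix_of L A G"
    and "unimodular_mat A"
  shows "\<exists>P \<in> carrier_mat p m. G = to_rat_mat P \<and> linearization_of L P"
proof -
  interpret semiring_hom "to_fract :: 'a poly \<Rightarrow> 'a poly fract"
    by unfold_locales auto
  let ?B = "linear_mat B1 B0" and ?C = "linear_mat C1 C0" and ?D = "linear_mat D1 D0"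
  have A: "A \<in> carrier_mat n n" and B: "?B \<in> carrier_mat n m"
    and C: "?C \<in> carrier_mat p n" and D: "?D \<in> carrier_mat p m"
    using assms(2-10) by (auto intro: linear_mat_carrier)
  obtain X where X: "X \<in> carrier_mat n n" "A * X = 1\<^sub>m n" "X * A = 1\<^sub>m n"
    using unimodular_mat_obtain_inverse[OF A assms(13)] .
  let ?P = "?D + ?C * X * ?B"
  have CX: "?C * X \<in> carrier_mat p n" and CXB: "?C * X * ?B \<in> carrier_mat p m"
    using B C X(1) by auto
  have sys: "system_matrix_of (four_block_mat A ?B (- ?C) ?D) A G"
    and pencil: "pencil (four_block_mat A ?B (- ?C) ?D)"
    using assms(11,12) unfolding linear_system_matrix_of_def by auto
  have "G = to_rat_mat ?D + to_rat_mat ?C * to_rat_mat X * to_rat_mat ?B"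
    using system_matrix_of_four_block_matD[OF A B C D sys]
      mat_inverse_to_rat_mat[OF A X] by simp
  also have "\<dots> = to_rat_mat ?D + to_rat_mat (?C * X * ?B)"
    using mat_hom_mult[OF CX B] mat_hom_mult[OF C X(1)] by simp
  also have "\<dots> = to_rat_mat ?P"
    using to_rat_mat_add[OF D CXB] by (rule sym)
  finally have "G = to_rat_mat ?P" .
  moreover have "linearization_of L ?P"
    unfolding assms(11) by (rule linearization_of_schur_complement[OF A B C D X(1,3) pencil])
  moreover have "?P \<in> carrier_mat p m"
    using CXB by (rule add_carrier_mat)
  ultimately show ?thesis
    by (intro bexI conjI)
qed

end
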